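(* Let $k\ge1$ be an integer and $\ell\ge1$ real. For any $0<\delta'\le1$ there is a $k$-service instance $(C,L,k,d,\ell)$ with $C\subseteq L$ and a clustering $\mathcal{C}$ of $C$ such that, for every $\varepsilon$ and every execution of the algorithm List-k-service$(C,L,k,d,\ell,\varepsilon)$, every $k$-center-set $S$ in the output list satisfies $\Psi(S,\mathcal{C})\ge(2^{\ell}-\delta')\cdot\Psi^*(\mathcal{C})$; i.e. the algorithm does not provide better than a $(2^{\ell}-\delta')$ approximation guarantee.
   Context: A $k$-service instance: metric space $(\mathcal{X},d)$, finite facility locations $L\subseteq\mathcal{X}$, finite clients $C\subseteq\mathcal{X}$, integer $k>0$, real $\ell\ge1$. $\Phi(F,S)=\sum_{x\in S}\min_{f\in F}d^{\ell}(f,x)$. A $k$-center-set is a set of $k$ distinct elements of $L$; for a partition $\mathcal{C}=\{C_1,\dots,C_k\}$ of $C$, $\Psi(F,\mathcal{C})=\min_\pi\sum_i\sum_{x\in C_i}d^{\ell}(x,f_{\pi(i)})$ and $\Psi^*(\mathcal{C})=\min_F\Psi(F,\mathcal{C})$ over $k$-center-sets. Algorithm List-k-service$(C,L,k,d,\ell,\varepsilon)$: let $\beta=4^{\ell-1}(\ell^{\ell}3^{\ell^2+4\ell+3}/\varepsilon^{\ell+1}+1)$, $\gamma=\ell^{\ell}3^{\ell^2+5\ell+1}/\varepsilon^{\ell}$, $\eta=\alpha\beta\gamma k\,3^{\ell+2}/\varepsilon^2$. (1) Run any $\alpha$-approximation algorithm for the unconstrained $k$-service instance with both clients and candidate centers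 equal to $C$, obtaining $F\subseteq C$. (2) $\mathcal{L}\leftarrow\emptyset$. (3) Repeat $2^k$ times: sample a multiset $M$ of $\eta k$ points from $C$ independently by $D^{\ell}$-sampling w.r.t. $F$ (point $x$ chosen with probability $\Phi(F,\{x\})/\Phi(F,C)$); set $M\leftarrow M\cup F$; let $T$ be the union over $x\in M$ of the $k$ points of $L$ closest to $x$; add every $k$-element subset of $T$ to $\mathcal{L}$. (4) Return $\mathcal{L}$. *)

theory Defs
  imports "HOL-Probability.Probability"
begin

locale k_service_instance = Metric_space X d
  for X :: "'a set" and d :: "'a \<Rightarrow> 'a \<Rightarrow> real" +
  fixes L C :: "'a set" and k :: nat and l :: real
  assumes L_subset: "L \<subseteq> X" and finite_L: "finite L"
    and C_subset: "C \<subseteq> X" and finite_C: "finite C"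
    and k_pos: "k > 0" and l_ge_1: "l \<ge> 1"

definition Phi :: "('a \<Rightarrow> 'a \<Rightarrow> real) \<Rightarrow> real \<Rightarrow> 'a set \<Rightarrow> 'a set \<Rightarrow> real" where
  "Phi d l F S = (\<Sum>x\<in>S. Min ((\<lambda>f. d f x powr l) ` F))"

definition k_center_sets :: "nat \<Rightarrow> 'a set \<Rightarrow> 'a set set" where
  "k_center_sets k L = {F. F \<subseteq> L \<and> card F = k}"

definition k_clustering :: "nat \<Rightarrow> 'a set \<Rightarrow> 'a set set \<Rightarrow> bool" where
  "k_clustering k C \<C> \<longleftrightarrow> partition_on C \<C> \<and> card \<C> = k"

text \<open>As neither the clusters nor the centers carry indices, a permutation becomes a bijection
  from the clusters onto the centers; extensionality keeps the set of these bijections finite.\<close>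

definition assignments :: "'a set set \<Rightarrow> 'a set \<Rightarrow> ('a set \<Rightarrow> 'a) set" where
  "assignments \<C> F = {\<pi> \<in> \<C> \<rightarrow>\<^sub>E F. bij_betw \<pi> \<C> F}"

definition Psi :: "('a \<Rightarrow> 'a \<Rightarrow> real) \<Rightarrow> real \<Rightarrow> 'a set \<Rightarrow> 'a set set \<Rightarrow> real" where
  "Psi d l F \<C> = Min ((\<lambda>\<pi>. \<Sum>A\<in>\<C>. \<Sum>x\<in>A. d x (\<pi> A) powr l) ` assignments \<C> F)"

definition Psi_opt :: "('a \<Rightarrow> 'a \<Rightarrow> real) \<Rightarrow> real \<Rightarrow> nat \<Rightarrow> 'a set \<Rightarrow> 'a set set \<Rightarrow> real" where
  "Psi_opt d l k L \<C> = Min ((\<lambda>F. Psi d l F \<C>) ` k_center_sets k L)"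

text \<open>The possible outputs of an \<open>\<alpha>\<close>-approximation algorithm for the unconstrained problem with
  clients \<open>C\<close> and candidate centers \<open>L\<close>.\<close>

definition approx_solution ::
    "real \<Rightarrow> ('a \<Rightarrow> 'a \<Rightarrow> real) \<Rightarrow> real \<Rightarrow> nat \<Rightarrow> 'a set \<Rightarrow> 'a set \<Rightarrow> 'a set \<Rightarrow> bool" where
  "approx_solution \<alpha> d l k L C F \<longleftrightarrow> F \<in> k_center_sets k L \<and>
     Phi d l F C \<le> \<alpha> * Min ((\<lambda>G. Phi d l G C) ` k_center_sets k L)"

text \<open>The probabilities sum to one exactly if \<open>Phi d l F C \<noteq> 0\<close>; otherwise the distribution is
  unspecified.\<close>

definition D_sampling :: "('a \<Rightarrow> 'a \<Rightarrow> real) \<Rightarrow> real \<Rightarrow> 'a set \<Rightarrow> 'a set \<Rightarrow> 'a pmf" where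
  "D_sampling d l F C = embed_pmf (\<lambda>x. if x \<in> C then Phi d l F {x} / Phi d l F C else 0)"

lemma pmf_D_sampling:
  assumes "finite C" "finite F" "F \<noteq> {}" "Phi d l F C \<noteq> 0"
  shows "pmf (D_sampling d l F C) x = (if x \<in> C then Phi d l F {x} / Phi d l F C else 0)"
proof -
  let ?p = "\<lambda>x. if x \<in> C then Phi d l F {x} / Phi d l F C else 0"
  have nonneg: "Phi d l F S \<ge> 0" for S
    unfolding Phi_def using assms by (intro sum_nonneg) simp
  have "(\<integral>\<^sup>+ x. ennreal (?p x) \<partial>count_space UNIV) = (\<Sum>x\<in>C. ennreal (?p x))"
    using assms by (intro nn_integral_count_space') auto
  also have "\<dots> = ennreal (\<Sum>x\<in>C. ?p x)"
    using nonneg by (intro sum_ennreal) auto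
  also have "(\<Sum>x\<in>C. ?p x) = (\<Sum>x\<in>C. Phi d l F {x}) / Phi d l F C"
    by (simp add: sum_divide_distrib)
  also have "(\<Sum>x\<in>C. Phi d l F {x}) = Phi d l F C"
    by (simp add: Phi_def)
  finally have "(\<integral>\<^sup>+ x. ennreal (?p x) \<partial>count_space UNIV) = 1"
    using assms by simp
  then show ?thesis
    unfolding D_sampling_def using nonneg by (intro pmf_embed_pmf) auto
qed

text \<open>Ties are broken by a rule \<open>N\<close>, with \<open>N x\<close> the chosen set of \<open>k\<close> points of \<open>L\<close> closest to
  \<open>x\<close>.\<close>

definition closest_points_rule ::
    "('a \<Rightarrow> 'a \<Rightarrow> real) \<Rightarrow> nat \<Rightarrow> 'a set \<Rightarrow> 'a set \<Rightarrow> ('a \<Rightarrow> 'a set) \<Rightarrow> bool" where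
  "closest_points_rule d k L C N \<longleftrightarrow>
     (\<forall>x\<in>C. N x \<subseteq> L \<and> card (N x) = k \<and> (\<forall>y\<in>N x. \<forall>z\<in>L - N x. d x y \<le> d x z))"

definition beta :: "real \<Rightarrow> real \<Rightarrow> real" where
  "beta l \<epsilon> = 4 powr (l - 1) *
     (l powr l * 3 powr (l\<^sup>2 + 4 * l + 3) / \<epsilon> powr (l + 1) + 1)"

definition gamma :: "real \<Rightarrow> real \<Rightarrow> real" where
  "gamma l \<epsilon> = l powr l * 3 powr (l\<^sup>2 + 5 * l + 1) / \<epsilon> powr l"

definition eta :: "real \<Rightarrow> real \<Rightarrow> nat \<Rightarrow> real \<Rightarrow> real" where
  "eta \<alpha> l k \<epsilon> = \<alpha> * beta l \<epsilon> * gamma l \<epsilon> * real k * 3 powr (l + 2) / \<epsilon>\<^sup>2"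

definition sample_size :: "real \<Rightarrow> real \<Rightarrow> nat \<Rightarrow> real \<Rightarrow> nat" where
  "sample_size \<alpha> l k \<epsilon> = nat \<lceil>eta \<alpha> l k \<epsilon> * real k\<rceil>"

text \<open>One repetition. The multiset \<open>M\<close> is drawn as a sequence, of which only the underlying set
  matters for the result.\<close>

definition iteration ::
    "'a set \<Rightarrow> 'a set \<Rightarrow> nat \<Rightarrow> ('a \<Rightarrow> 'a \<Rightarrow> real) \<Rightarrow> real \<Rightarrow> real \<Rightarrow> real \<Rightarrow>
     'a set \<Rightarrow> ('a \<Rightarrow> 'a set) \<Rightarrow> 'a set set pmf" where
  "iteration C L k d l \<epsilon> \<alpha> F N =
     map_pmf (\<lambda>M. let T = (\<Union>x \<in> set M \<union> F. N x) in {S. S \<subseteq> T \<and> card S = k})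
       (replicate_pmf (sample_size \<alpha> l k \<epsilon>) (D_sampling d l F C))"

text \<open>The distribution of the output list, given the outcome \<open>F\<close> of the initial
  \<open>\<alpha>\<close>-approximation and the tie-breaking rule \<open>N\<close>.\<close>

definition list_k_service ::
    "'a set \<Rightarrow> 'a set \<Rightarrow> nat \<Rightarrow> ('a \<Rightarrow> 'a \<Rightarrow> real) \<Rightarrow> real \<Rightarrow> real \<Rightarrow> real \<Rightarrow>
     'a set \<Rightarrow> ('a \<Rightarrow> 'a set) \<Rightarrow> 'a set set pmf" where
  "list_k_service C L k d l \<epsilon> \<alpha> F N =
     map_pmf (\<lambda>Ls. \<Union>(set Ls)) (replicate_pmf (2 ^ k) (iteration C L k d l \<epsilon> \<alpha> F N))"

text \<open>An execution with positive probability that returns \<open>\<L>\<close>, for some outcome of the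
  \<open>\<alpha>\<close>-approximation on \<open>(C, C)\<close> and some way of breaking ties.\<close>

definition list_k_service_output ::
    "'a set \<Rightarrow> 'a set \<Rightarrow> nat \<Rightarrow> ('a \<Rightarrow> 'a \<Rightarrow> real) \<Rightarrow> real \<Rightarrow> real \<Rightarrow> real \<Rightarrow> 'a set set \<Rightarrow> bool" where
  "list_k_service_output C L k d l \<epsilon> \<alpha> \<L> \<longleftrightarrow>
     (\<exists>F N. approx_solution \<alpha> d l k C C F \<and> closest_points_rule d k L C N \<and>
       \<L> \<in> set_pmf (list_k_service C L k d l \<epsilon> \<alpha> F N))"

end

theory Submission
  imports Defs
begin

text \<open>A hub at distance 1 from all other points, which are grouped into blocks of \<open>k\<close> consecutive
  points: distance 1/2 within a block and 2 between blocks. The clients are all points but the hub.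
  The \<open>k\<close> locations closest to a client form its own block, so the hub never becomes a
  candidate center. The clustering has one huge cluster and \<open>k - 1\<close> singletons. The hub serves each
  client of the huge cluster at cost 1, whereas any other center pays \<open>2\<^sup>l\<close> outside its block,
  that is, for all but \<open>k\<close> of these clients.\<close>

section \<open>Bounds on the clustering cost \<open>Psi\<close>\<close>

lemma assignments_nonempty:
  assumes "finite \<C>" "finite F" "card \<C> = card F"
  shows "assignments \<C> F \<noteq> {}"
proof -
  obtain h where h: "bij_betw h \<C> F"
    using finite_same_card_bij assms by blast
  have "bij_betw (restrict h \<C>) \<C> F"
    using h by (simp cong: bij_betw_cong)
  moreover have "restrict h \<C> \<in> \<C> \<rightarrow>\<^sub>E F"
    using h by (auto simp: bij_betw_def)
  ultimately show ?thesis
    unfolding assignments_def by blast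
qed

lemma finite_assignments:
  assumes "finite \<C>" "finite F"
  shows "finite (assignments \<C> F)"
  using finite_PiE[OF assms(1), of "\<lambda>_. F"] assms(2) by (simp add: assignments_def)

lemma Psi_le:
  assumes "finite \<C>" "finite F" "\<pi> \<in> assignments \<C> F"
  shows "Psi d l F \<C> \<le> (\<Sum>A\<in>\<C>. \<Sum>x\<in>A. d x (\<pi> A) powr l)"
  unfolding Psi_def using assms by (intro Min_le) (auto simp: finite_assignments)

text \<open>Costs are nonnegative, so one cluster already bounds the total. The bound is asked for
  all centers because \<open>B\<close> may be matched to any of them. Equal cardinalities provide a
  bijection, so that \<open>Min\<close> ranges over a nonempty set.\<close>

lemma Psi_ge_cluster:
  assumes "finite \<C>" "finite F" "card \<C> = card F" "B \<in> \<C>"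
    and bound: "\<And>c. c \<in> F \<Longrightarrow> b \<le> (\<Sum>x\<in>B. d x c powr l)"
  shows "b \<le> Psi d l F \<C>"
proof -
  have "b \<le> (\<Sum>A\<in>\<C>. \<Sum>x\<in>A. d x (\<pi> A) powr l)" if "\<pi> \<in> assignments \<C> F" for \<pi>
  proof -
    have "\<pi> B \<in> F"
      using that assms(4) by (auto simp: assignments_def)
    then have "b \<le> (\<Sum>x\<in>B. d x (\<pi> B) powr l)"
      by (rule bound)
    also have "\<dots> \<le> (\<Sum>A\<in>\<C>. \<Sum>x\<in>A. d x (\<pi> A) powr l)"
      using assms(1,4) by (intro member_le_sum) (auto intro: sum_nonneg)
    finally show ?thesis .
  qed
  then show ?thesis
    unfolding Psi_def using assms
    by (subst Min_ge_iff) (auto simp: finite_assignments assignments_nonempty)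
qed

lemma finite_k_center_sets: "finite L \<Longrightarrow> finite (k_center_sets k L)"
  by (simp add: k_center_sets_def)

section \<open>Support of the algorithm's output\<close>

context Metric_space
begin

text \<open>Some client lies outside \<open>F\<close>, at positive distance from every center. This
  is what makes the sampling probabilities well defined.\<close>

lemma Phi_pos:
  assumes "C \<subseteq> M" "finite C" "F \<subseteq> C" "F \<noteq> {}" "card F < card C"
  shows "Phi d l F C > 0"
proof -
  have finF: "finite F"
    using assms(2,3) by (rule rev_finite_subset)
  obtain x where x: "x \<in> C" "x \<notin> F"
    using assms(3,5) by (metis less_irrefl subsetI subset_antisym)
  have "d f x \<noteq> 0" if "f \<in> F" for f
    using that x assms by (metis subsetD zero)
  then have "Min ((\<lambda>f. d f x powr l) ` F) > 0"
    using finF \<open>F \<noteq> {}\<close> by simp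
  moreover have "Min ((\<lambda>f. d f y powr l) ` F) \<ge> 0" for y
    using finF \<open>F \<noteq> {}\<close> by simp
  ultimately show ?thesis
    unfolding Phi_def using assms(2) x by (intro sum_pos2)
qed

text \<open>Sampled points and initial centers are all clients, so candidates come only from
  neighbor sets of clients. Since only supports are used, this covers every execution, whatever the
  sample size.\<close>

lemma list_k_service_output_centers:
  assumes C: "C \<subseteq> M" "finite C" and k: "0 < k" "k < card C"
    and out: "list_k_service_output C L k d l \<epsilon> \<alpha> \<L>" and S: "S \<in> \<L>"
  shows "card S = k"
    and "\<exists>N. closest_points_rule d k L C N \<and> S \<subseteq> (\<Union>x\<in>C. N x)"
proof -
  obtain F N where F: "approx_solution \<alpha> d l k C C F" and N: "closest_points_rule d k L C N"
    and L: "\<L> \<in> set_pmf (list_k_service C L k d l \<epsilon> \<alpha> F N)"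
    using out by (auto simp: list_k_service_output_def)
  have F': "F \<subseteq> C" "card F = k"
    using F by (auto simp: approx_solution_def k_center_sets_def)
  then have F_fin: "finite F" "F \<noteq> {}"
    using k by (auto intro: card_ge_0_finite)
  have "Phi d l F C \<noteq> 0"
    using Phi_pos[OF C F'(1) F_fin(2), of l] F'(2) k by simp
  then have D: "set_pmf (D_sampling d l F C) \<subseteq> C"
    using C(2) F_fin by (auto simp: set_pmf_eq pmf_D_sampling)
  obtain As where "S \<in> As" and As: "As \<in> set_pmf (iteration C L k d l \<epsilon> \<alpha> F N)"
    using L S by (auto simp: list_k_service_def set_replicate_pmf)
  then obtain M where "M \<in> lists (set_pmf (D_sampling d l F C))"
    and S': "S \<subseteq> (\<Union>x\<in>set M \<union> F. N x)" "card S = k"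
    by (auto simp: iteration_def set_replicate_pmf Let_def)
  then have M: "set M \<union> F \<subseteq> C"
    using D F' by (auto simp: in_lists_conv_set)
  show "card S = k"
    by (fact S')
  show "\<exists>N. closest_points_rule d k L C N \<and> S \<subseteq> (\<Union>x\<in>C. N x)"
    using N order_trans[OF S'(1) UN_mono[OF M order_refl]] by blast
qed

end

section \<open>The hub metric\<close>

definition hub_dist :: "nat \<Rightarrow> nat \<Rightarrow> nat \<Rightarrow> nat \<Rightarrow> real" where
  "hub_dist k h p q =
     (if p = q then 0 else if p = h \<or> q = h then 1 else if p div k = q div k then 1/2 else 2)"

text \<open>The value 1/2 is below the hub distance 1, and two such legs still sum to 1. Distances
  never exceed 2.\<close>

interpretation hub: Metric_space X "hub_dist k h" for X k h
proof
  show "0 \<le> hub_dist k h x y" for x y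
    by (simp add: hub_dist_def)
  show "hub_dist k h x y = hub_dist k h y x" for x y
    by (auto simp: hub_dist_def)
  show "hub_dist k h x y = 0 \<longleftrightarrow> x = y" for x y
    by (simp add: hub_dist_def)
  have refl: "hub_dist k h x x = 0" for x
    by (simp add: hub_dist_def)
  have ge: "1/2 \<le> hub_dist k h x y" if "x \<noteq> y" for x y
    using that by (simp add: hub_dist_def)
  have le: "hub_dist k h x y \<le> 2" for x y
    by (simp add: hub_dist_def)
  show "hub_dist k h x z \<le> hub_dist k h x y + hub_dist k h y z" for x y z
  proof -
    \<comment> \<open>Apart from the degenerate case, either the direct distance is at most 1, or
      the detour passes through the hub and has length 2, or \<open>y\<close> is in another block
      than \<open>x\<close> or \<open>z\<close> and one leg alone is 2.\<close>
    consider "x = y \<or> y = z" | "x \<noteq> y" "y \<noteq> z" "x div k = z div k \<or> x = h \<or> z = h"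
      | "x \<noteq> y" "y \<noteq> z" "y = h" | "x \<noteq> y" "x \<noteq> h" "y \<noteq> h" "x div k \<noteq> y div k"
      | "y \<noteq> z" "y \<noteq> h" "z \<noteq> h" "y div k \<noteq> z div k"
      by metis
    then show ?thesis
    proof cases
      case 1
      then show ?thesis
        by (auto simp: refl)
    next
      case 2
      then have "hub_dist k h x z \<le> 1"
        by (auto simp: hub_dist_def)
      then show ?thesis
        using ge[of x y] ge[of y z] 2 by linarith
    next
      case 3
      then have "hub_dist k h x y = 1" "hub_dist k h y z = 1"
        by (auto simp: hub_dist_def)
      then show ?thesis
        using le[of x z] by linarith
    next
      case 4
      then have "hub_dist k h x y = 2" "0 \<le> hub_dist k h y z"
        by (auto simp: hub_dist_def)
      then show ?thesis
        using le[of x z] by linarith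
    next
      case 5
      then have "hub_dist k h y z = 2" "0 \<le> hub_dist k h x y"
        by (auto simp: hub_dist_def)
      then show ?thesis
        using le[of x z] by linarith
    qed
  qed
qed

lemma block_eq:
  fixes k g :: nat
  assumes "k > 0"
  shows "{p. p div k = g} = {g * k..<Suc g * k}"
proof (rule set_eqI)
  fix p
  have "p div k = g \<longleftrightarrow> g \<le> p div k \<and> p div k < Suc g"
    by auto
  then show "p \<in> {p. p div k = g} \<longleftrightarrow> p \<in> {g * k..<Suc g * k}"
    by (simp only: mem_Collect_eq atLeastLessThan_iff div_less_iff_less_mult[OF assms]
        less_eq_div_iff_mult_less_eq[OF assms])
qed

text \<open>By counting: the block of \<open>x\<close> has \<open>k\<close> points, none of them the
  hub. If \<open>N x\<close> held the hub, it would omit some point of that block, which is strictly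
  closer. Hence ties are irrelevant.\<close>

lemma hub_not_closest:
  assumes k: "k > 0" and N: "closest_points_rule (hub_dist k (n * k)) k {..n * k} {..<n * k} N"
    and x: "x < n * k"
  shows "n * k \<notin> N x"
proof
  let ?d = "hub_dist k (n * k)"
  let ?G = "{p. p div k = x div k}"
  assume hub: "n * k \<in> N x"
  have *: "N x \<subseteq> {..n * k}" "card (N x) = k" "\<forall>y\<in>N x. \<forall>z\<in>{..n * k} - N x. ?d x y \<le> ?d x z"
    using N x by (auto simp: closest_points_rule_def)
  \<comment> \<open>As \<open>n * k\<close> is a multiple of \<open>k\<close>, no block of a client
    is cut off at the hub.\<close>
  have G: "?G \<subseteq> {..<n * k}"
    using x by (metis (mono_tags, lifting) div_less_iff_less_mult k lessThan_iff mem_Collect_eq subsetI)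
  have "card ?G = k"
    using k by (simp add: block_eq)
  moreover have "finite (N x)"
    using * finite_subset by blast
  moreover have "?G \<noteq> N x"
    using G hub by blast
  ultimately have "\<not> ?G \<subseteq> N x"
    using card_subset_eq[of "N x" ?G] *(2) by blast
  then obtain g where g: "g \<in> ?G" "g \<notin> N x"
    by blast
  then have "g \<in> {..n * k} - N x"
    using G by auto
  then have "?d x (n * k) \<le> ?d x g"
    using *(3) hub by blast
  \<comment> \<open>The omitted point \<open>g\<close> may be \<open>x\<close> itself, hence an
    inequality.\<close>
  moreover have "?d x (n * k) = 1" "?d x g \<le> 1/2"
    using x g G by (auto simp: hub_dist_def)
  ultimately show False
    by simp
qed

text \<open>Discarding the block of \<open>c\<close> loses at most \<open>k\<close> points of
  \<open>B\<close>; all others are at the same distance from \<open>c\<close>, namely 1 or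
  2.\<close>

lemma cost_ge:
  assumes k: "k > 0" and B: "finite B" "h \<notin> B" and l: "l \<ge> 0"
  shows "(real (card B) - real k) * (if c = h then 1 else 2 powr l)
    \<le> (\<Sum>x\<in>B. hub_dist k h x c powr l)"
proof -
  let ?G = "{p. p div k = c div k}"
  let ?r = "if c = h then 1 else 2 powr l"
  have "card B - k \<le> card (B - ?G)"
    using diff_card_le_card_Diff[of ?G B] k by (simp add: block_eq)
  then have "(real (card B) - real k) * ?r \<le> real (card (B - ?G)) * ?r"
    by (intro mult_right_mono) auto
  also have "\<dots> = (\<Sum>x\<in>B - ?G. ?r)"
    by simp
  also have "\<dots> = (\<Sum>x\<in>B - ?G. hub_dist k h x c powr l)"
    using B by (intro sum.cong) (auto simp: hub_dist_def)
  also have "\<dots> \<le> (\<Sum>x\<in>B. hub_dist k h x c powr l)"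
    using B by (intro sum_mono2) auto
  finally show ?thesis .
qed

theorem theorem5:
  fixes k :: nat and l \<delta>' :: real
  assumes "k \<ge> 1" and "l \<ge> 1" and "0 < \<delta>'" and "\<delta>' \<le> 1"
  shows "\<exists>(X :: nat set) d L C \<C>.
    k_service_instance X d L C k l \<and> C \<subseteq> L \<and> k_clustering k C \<C> \<and>
    Psi_opt d l k L \<C> > 0 \<and>
    (\<forall>\<epsilon> \<alpha> \<L>. \<epsilon> > 0 \<and> \<alpha> \<ge> 1 \<and> list_k_service_output C L k d l \<epsilon> \<alpha> \<L> \<longrightarrow>
      (\<forall>S\<in>\<L>. Psi d l S \<C> \<ge> (2 powr l - \<delta>') * Psi_opt d l k L \<C>))"
proof -
  \<comment> \<open>Large enough that \<open>k * 2 powr l\<close>, the loss from one block, is at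
    most \<open>\<delta>'\<close> times the size of \<open>B\<close>; also \<open>n \<ge> 2\<close>,
    so \<open>B\<close> has more than \<open>k\<close> points.\<close>
  define n where "n = Suc (nat \<lceil>2 powr l / \<delta>'\<rceil>)"
  define h where "h = n * k"
  define d where "d = hub_dist k h"
  \<comment> \<open>The points below \<open>k - 1\<close> become the singletons; for
    \<open>k = 1\<close> there are none.\<close>
  define B where "B = {k - 1..<h}"
  define \<C> where "\<C> = insert B ((\<lambda>i. {i}) ` {..<k - 1})"
  have n_large: "2 powr l / \<delta>' \<le> real n - 1"
    unfolding n_def by simp linarith
  moreover have "2 powr l / \<delta>' > 0"
    using assms by simp
  ultimately have "n \<ge> 2"
    by linarith
  then have "2 * k \<le> h"
    unfolding h_def by simp
  then have h: "k < h"
    using assms by linarith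
  have "card B + k = n * k + 1"
    using h assms(1) by (simp add: B_def flip: h_def)
  then have "real (card B) + real k = real n * real k + 1"
    by (metis of_nat_1 of_nat_add of_nat_mult)
  then have card_B: "real (card B) = (real n - 1) * real k + 1"
    by (simp add: algebra_simps)
  have B: "finite B" "h \<notin> B" "B \<noteq> {}"
    using h by (auto simp: B_def)
  have "1 * real k \<le> (real n - 1) * real k"
    using \<open>n \<ge> 2\<close> by (intro mult_right_mono) auto
  then have card_B_gt: "real k < card B"
    using card_B by linarith
  \<comment> \<open>The point \<open>k\<close> shows that \<open>B\<close> is none of the
    singletons, so there are exactly \<open>k\<close> clusters.\<close>
  have "k \<in> B" "\<And>i. i < k - 1 \<Longrightarrow> k \<noteq> i"
    using h by (auto simp: B_def)
  then have B_notin: "B \<notin> (\<lambda>i. {i}) ` {..<k - 1}"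
    by auto
  have fin\<C>: "finite \<C>"
    by (simp add: \<C>_def)
  have card\<C>: "card \<C> = k"
    using assms(1) B_notin by (simp add: \<C>_def card_image)
  have "partition_on {..<h} \<C>"
    using h B unfolding \<C>_def B_def
    by (intro partition_onI) (auto simp: disjnt_def)
  then have clust: "k_clustering k {..<h} \<C>"
    using card\<C> by (simp add: k_clustering_def)
  have inst: "k_service_instance {..h} d {..h} {..<h} k l"
    using assms by (auto simp: k_service_instance_def k_service_instance_axioms_def d_def
        hub.Metric_space_axioms)

  have lower: "(real (card B) - real k) * (if h \<in> S then 1 else 2 powr l) \<le> Psi d l S \<C>"
    if "finite S" "card S = k" for S
  proof (rule Psi_ge_cluster)
    fix c assume "c \<in> S"
    have "(real (card B) - real k) * (if h \<in> S then 1 else 2 powr l)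
        \<le> (real (card B) - real k) * (if c = h then 1 else 2 powr l)"
      using \<open>c \<in> S\<close> card_B_gt assms(2) by (intro mult_left_mono) (auto simp: ge_one_powr_ge_zero)
    also have "\<dots> \<le> (\<Sum>x\<in>B. d x c powr l)"
      unfolding d_def using assms B by (intro cost_ge) auto
    finally show "(real (card B) - real k) * (if h \<in> S then 1 else 2 powr l)
        \<le> (\<Sum>x\<in>B. d x c powr l)" .
  qed (use that fin\<C> card\<C> in \<open>auto simp: \<C>_def\<close>)

  define F where "F = insert h {..<k - 1}"
  \<comment> \<open>\<open>Min\<close> extracts the element of a singleton, so each singleton
    cluster is served by its own point at cost 0.\<close>
  define \<pi> where "\<pi> = restrict (\<lambda>A. if A = B then h else Min A) \<C>"
  have F: "F \<in> k_center_sets k {..h}"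
    using h assms(1) by (auto simp: F_def k_center_sets_def)
  have \<pi>B: "\<pi> B = h" and \<pi>_single: "\<And>i. i < k - 1 \<Longrightarrow> \<pi> {i} = i"
    using B_notin by (auto simp: \<pi>_def \<C>_def)
  have "bij_betw \<pi> \<C> F"
    unfolding bij_betw_def
  proof
    show "\<pi> ` \<C> = F"
      using \<pi>B \<pi>_single by (force simp: \<C>_def F_def)
    \<comment> \<open>Injectivity follows from surjectivity, as both sides have \<open>k\<close>
      elements.\<close>
    then show "inj_on \<pi> \<C>"
      using F card\<C> fin\<C> by (intro eq_card_imp_inj_on) (auto simp: k_center_sets_def)
  qed
  moreover from this have "\<pi> \<in> \<C> \<rightarrow> F"
    by (rule bij_betw_imp_funcset)
  moreover have "\<pi> \<in> extensional \<C>"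
    by (simp add: \<pi>_def)
  ultimately have \<pi>: "\<pi> \<in> assignments \<C> F"
    by (simp add: assignments_def PiE_def)
  have "Psi_opt d l k {..h} \<C> \<le> Psi d l F \<C>"
    unfolding Psi_opt_def using F by (intro Min_le) (auto simp: finite_k_center_sets)
  also have "\<dots> \<le> (\<Sum>A\<in>\<C>. \<Sum>x\<in>A. d x (\<pi> A) powr l)"
    using \<pi> fin\<C> by (intro Psi_le) (auto simp: F_def)
  also have "\<dots> = (\<Sum>x\<in>B. d x h powr l) + (\<Sum>i<k - 1. d i i powr l)"
    using B_notin by (simp add: \<C>_def \<pi>B \<pi>_single sum.reindex)
  also have "(\<Sum>x\<in>B. d x h powr l) = (\<Sum>x\<in>B. 1)"
    using B by (intro sum.cong) (auto simp: d_def hub_dist_def)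
  also have "(\<Sum>i<k - 1. d i i powr l) = 0"
    by (simp add: d_def hub_dist_def)
  finally have upper: "Psi_opt d l k {..h} \<C> \<le> card B"
    by simp

  \<comment> \<open>A zero optimum would make the claimed ratio trivial.\<close>
  have "Psi_opt d l k {..h} \<C> > 0"
    unfolding Psi_opt_def
  proof (subst Min_gr_iff)
    show "\<forall>a\<in>(\<lambda>F. Psi d l F \<C>) ` k_center_sets k {..h}. 0 < a"
    proof clarify
      fix G assume "G \<in> k_center_sets k {..h}"
      then have "finite G" "card G = k"
        by (auto simp: k_center_sets_def finite_subset)
      have "0 < (real (card B) - real k) * (if h \<in> G then 1 else 2 powr l)"
        using card_B_gt by simp
      then show "0 < Psi d l G \<C>"
        using lower[OF \<open>finite G\<close> \<open>card G = k\<close>] by linarith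
    qed
  qed (use F in \<open>auto simp: finite_k_center_sets\<close>)
  moreover have "(2 powr l - \<delta>') * Psi_opt d l k {..h} \<C> \<le> Psi d l S \<C>"
    if out: "list_k_service_output {..<h} {..h} k d l \<epsilon> \<alpha> \<L>" and S: "S \<in> \<L>" for \<epsilon> \<alpha> \<L> S
  proof -
    obtain N where N: "closest_points_rule d k {..h} {..<h} N" and "S \<subseteq> (\<Union>x<h. N x)"
      and card: "card S = k"
      using hub.list_k_service_output_centers[of "{..<h}" UNIV k "{..h}" k h l \<epsilon> \<alpha> \<L> S]
        out S h assms(1) by (auto simp: d_def)
    then have "h \<notin> S"
      using hub_not_closest[of k n N] assms(1) by (fastforce simp: d_def h_def)
    have "finite S"
      using card assms(1) card_ge_0_finite by force
    \<comment> \<open>With \<open>\<delta>' \<le> 1\<close> this makes the factor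
      \<open>2 powr l - \<delta>'\<close> nonnegative, so the upper bound on the optimum may be
      multiplied by it.\<close>
    have "2 powr l \<ge> 1"
      using assms(2) by (intro ge_one_powr_ge_zero) auto
    then have "(2 powr l - \<delta>') * Psi_opt d l k {..h} \<C> \<le> (2 powr l - \<delta>') * card B"
      using upper assms(4) by (intro mult_left_mono) auto
    also have "\<dots> \<le> (real (card B) - real k) * 2 powr l"
    proof -
      have "2 powr l * k \<le> \<delta>' * (real n - 1) * k"
        using n_large assms(3) by (intro mult_right_mono) (auto simp: field_simps)
      also have "\<dots> \<le> \<delta>' * card B"
        using assms(3) by (simp add: card_B algebra_simps)
      finally show ?thesis
        by (simp add: algebra_simps)
    qed
    also have "\<dots> \<le> Psi d l S \<C>"
      using lower[OF \<open>finite S\<close> card] \<open>h \<notin> S\<close> by simp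
    finally show ?thesis .
  qed
  ultimately show ?thesis
    using inst clust by (intro exI[of _ "{..h}"] exI[of _ d] exI[of _ "{..<h}"] exI[of _ \<C>]) auto
qed

end
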